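(* Let $G$ be a finite simple connected graph. Then $G$ is square-stable, i.e. $\alpha(G)=\alpha(G^2)$, if and only if there is some $S\in\Omega(G)$ such that $\mathrm{dist}_G(a,b)\ge 3$ holds for all distinct $a,b\in S$.
   Context: $G^2$ is the graph on $V(G)$ in which distinct vertices $v,w$ are adjacent iff $\mathrm{dist}_G(v,w)\le 2$. $\alpha(G)$ is the maximum cardinality of a stable (independent) set, and $\Omega(G)$ is the set of all maximum (cardinality) stable sets of $G$. *)

theory Defs
  imports "Graph_Theory.Graph_Theory"
begin

text \<open>Following the Graph_Theory entry, a finite simple graph is a finite loopless symmetric
  digraph without parallel arcs, \<^locale>\<open>pair_graph\<close>: an undirected edge is a pair of opposite arcs.\<close>

text \<open>The distance is the infimum of the lengths of walks, so it is \<open>\<infinity>\<close> between different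
  components. It is written as the library's minimal walk cost for unit arc weights.\<close>

definition graph_dist :: "'a pair_pre_digraph \<Rightarrow> 'a \<Rightarrow> 'a \<Rightarrow> ereal" where
  "graph_dist G u v = wf_digraph.\<mu> (with_proj G) (\<lambda>_. 1) u v"

definition graph_square :: "'a pair_pre_digraph \<Rightarrow> 'a pair_pre_digraph" where
  "graph_square G = \<lparr> pverts = pverts G,
     parcs = {(v, w). v \<in> pverts G \<and> w \<in> pverts G \<and> v \<noteq> w \<and> graph_dist G v w \<le> 2} \<rparr>"

lemma (in pair_sym_digraph) graph_dist_sym: "graph_dist G u v = graph_dist G v u"
proof -
  have cost: "awalk_cost (\<lambda>_. 1) (rev_path p) = awalk_cost (\<lambda>_. 1) p" for p
    by (induction p) auto
  have "graph_dist G v u \<le> graph_dist G u v" for u v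
    unfolding graph_dist_def \<mu>_def
    by (rule INF_mono) (metis awalk_rev_path cost mem_Collect_eq order_refl)
  then show ?thesis by (simp add: antisym)
qed

lemma (in pair_graph) pair_graph_graph_square: "pair_graph (graph_square G)"
proof
  show "finite (parcs (graph_square G))"
    by (rule finite_subset[of _ "pverts G \<times> pverts G"])
       (auto simp: graph_square_def pair_finite_verts)
  show "symmetric (with_proj (graph_square G))"
    by (auto simp: symmetric_def graph_square_def graph_dist_sym intro!: symI)
qed (auto simp: graph_square_def pair_finite_verts)

definition stable_set :: "'a pair_pre_digraph \<Rightarrow> 'a set \<Rightarrow> bool" where
  "stable_set G S \<longleftrightarrow> S \<subseteq> pverts G \<and> (\<forall>u\<in>S. \<forall>v\<in>S. (u, v) \<notin> parcs G)"

definition stability_number :: "'a pair_pre_digraph \<Rightarrow> nat" where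
  "stability_number G = Max (card ` {S. stable_set G S})"

definition max_stable_sets :: "'a pair_pre_digraph \<Rightarrow> 'a set set" where
  "max_stable_sets G = {S. stable_set G S \<and> card S = stability_number G}"

definition square_stable :: "'a pair_pre_digraph \<Rightarrow> bool" where
  "square_stable G \<longleftrightarrow> stability_number G = stability_number (graph_square G)"

end

theory Submission
  imports Defs
begin

text \<open>A set of vertices is stable in the square of \<open>G\<close> exactly if its distinct members have pairwise
  distance greater than 2, that is at least 3, since distances are integers or infinite
  (\<open>stable_set_graph_square_iff\<close>). Adjacent vertices are at distance at most 1, so the stable sets of
  the square are also stable in \<open>G\<close>, and the stability number can only drop on passing to the square
  (\<open>stability_number_graph_square_le\<close>). Hence the two stability numbers agree if and only if some
  stable set of the square has the cardinality of a maximum stable set of \<open>G\<close>. Such a set is itself a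
  maximum stable set of \<open>G\<close>, and it is precisely one whose distinct members are at distance at
  least 3.\<close>

text \<open>Unit-weight walk costs are lengths, hence integers, so there is no distance strictly between
  2 and 3. Without a walk from \<open>u\<close> to \<open>v\<close> the distance is an empty infimum, which is \<open>\<infinity>\<close>.\<close>
lemma not_graph_dist_le_2_iff: "\<not> graph_dist G u v \<le> 2 \<longleftrightarrow> graph_dist G u v \<ge> 3"
  if "pair_graph G"
proof
  interpret pair_graph G by fact
  have cost: "awalk_cost (\<lambda>_. 1) p = real (length p)" for p :: "('a \<times> 'a) list"
    by (induction p) auto
  assume far: "\<not> graph_dist G u v \<le> 2"
  show "graph_dist G u v \<ge> 3"
    unfolding graph_dist_def \<mu>_def
  proof (rule INF_greatest)
    fix p assume "p \<in> {p. awalk u p v}"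
    then have "graph_dist G u v \<le> ereal (awalk_cost (\<lambda>_. 1) p)"
      unfolding graph_dist_def by (simp add: min_cost_le_walk_cost)
    with far have "\<not> ereal (real (length p)) \<le> 2"
      unfolding cost by (meson order_trans)
    then have "3 \<le> length p" by simp
    then show "3 \<le> ereal (awalk_cost (\<lambda>_. 1) p)"
      unfolding cost by simp
  qed
next
  assume "graph_dist G u v \<ge> 3"
  then have "3 \<le> (2 :: ereal)" if "graph_dist G u v \<le> 2"
    using that by (rule order_trans)
  then show "\<not> graph_dist G u v \<le> 2" by auto
qed

lemma (in pair_graph) graph_dist_le_1_if_arc:
  assumes "(u, v) \<in> parcs G"
  shows "graph_dist G u v \<le> 1"
proof -
  have "awalk u [(u, v)] v"
    using arc_implies_awalk[of "(u, v)"] assms by simp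
  then have "graph_dist G u v \<le> ereal (awalk_cost (\<lambda>_. 1) [(u, v)])"
    unfolding graph_dist_def by (rule min_cost_le_walk_cost)
  then show ?thesis by (simp add: one_ereal_def)
qed

lemma stable_set_graph_square_iff:
  assumes "pair_graph G"
  shows "stable_set (graph_square G) S \<longleftrightarrow>
    S \<subseteq> pverts G \<and> (\<forall>a\<in>S. \<forall>b\<in>S. a \<noteq> b \<longrightarrow> graph_dist G a b \<ge> 3)"
  unfolding not_graph_dist_le_2_iff[OF assms, symmetric]
  by (auto simp: stable_set_def graph_square_def)

lemma stable_set_if_stable_set_graph_square:
  assumes "pair_graph G" and "stable_set (graph_square G) S"
  shows "stable_set G S"
proof -
  interpret pair_graph G by fact
  have "(u, v) \<in> parcs (graph_square G)" if "(u, v) \<in> parcs G" for u v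
  proof -
    have "graph_dist G u v \<le> 2"
      using graph_dist_le_1_if_arc[OF that] by (rule order_trans) simp
    moreover have "u \<noteq> v"
      using pair_no_loops[OF that] by simp
    ultimately show ?thesis
      using that by (auto simp: graph_square_def dest: in_arcsD1 in_arcsD2)
  qed
  moreover have "S \<subseteq> pverts G"
    using assms(2) by (simp add: stable_set_def graph_square_def)
  ultimately show ?thesis
    using assms(2) unfolding stable_set_def by blast
qed

lemma finite_stable_sets:
  assumes "finite (pverts G)"
  shows "finite {S. stable_set G S}"
  by (rule finite_subset[of _ "Pow (pverts G)"]) (use assms in \<open>auto simp: stable_set_def\<close>)

lemma card_le_stability_number:
  assumes "finite (pverts G)" and "stable_set G S"
  shows "card S \<le> stability_number G"
  unfolding stability_number_def using assms by (intro Max_ge) (auto intro: finite_stable_sets)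

lemma max_stable_set_exists:
  assumes "finite (pverts G)"
  obtains S where "S \<in> max_stable_sets G"
proof -
  have "stable_set G {}" by (simp add: stable_set_def)
  then have "stability_number G \<in> card ` {S. stable_set G S}"
    unfolding stability_number_def using assms by (intro Max_in) (auto intro: finite_stable_sets)
  then show ?thesis using that by (auto simp: max_stable_sets_def)
qed

lemma stability_number_graph_square_le:
  assumes "pair_graph G"
  shows "stability_number (graph_square G) \<le> stability_number G"
proof -
  interpret pair_graph G by fact
  obtain S where "S \<in> max_stable_sets (graph_square G)"
    by (rule max_stable_set_exists[of "graph_square G"]) (simp add: graph_square_def)
  then have "stable_set G S" and "card S = stability_number (graph_square G)"
    using stable_set_if_stable_set_graph_square[OF assms] by (auto simp: max_stable_sets_def)
  then show ?thesis
    using card_le_stability_number[OF pair_finite_verts, of S] by simp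
qed

theorem proposition2p4:
  fixes G :: "'a pair_pre_digraph"
  assumes "pair_graph G" and "Digraph_Component.connected (with_proj G)"
  shows "square_stable G \<longleftrightarrow>
    (\<exists>S \<in> max_stable_sets G. \<forall>a\<in>S. \<forall>b\<in>S. a \<noteq> b \<longrightarrow> graph_dist G a b \<ge> 3)"
proof -
  interpret pair_graph G by fact
  have fin: "finite (pverts (graph_square G))" by (simp add: graph_square_def)
  show ?thesis
  proof
    assume "square_stable G"
    obtain S where S: "S \<in> max_stable_sets (graph_square G)"
      using max_stable_set_exists[OF fin] .
    then have stable: "stable_set (graph_square G) S" by (simp add: max_stable_sets_def)
    have "S \<in> max_stable_sets G"
      using S \<open>square_stable G\<close> stable_set_if_stable_set_graph_square[OF assms(1) stable]
      by (simp add: max_stable_sets_def square_stable_def)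
    with stable show "\<exists>S \<in> max_stable_sets G. \<forall>a\<in>S. \<forall>b\<in>S. a \<noteq> b \<longrightarrow> graph_dist G a b \<ge> 3"
      unfolding stable_set_graph_square_iff[OF assms(1)] by blast
  next
    assume "\<exists>S \<in> max_stable_sets G. \<forall>a\<in>S. \<forall>b\<in>S. a \<noteq> b \<longrightarrow> graph_dist G a b \<ge> 3"
    then obtain S where S: "S \<in> max_stable_sets G"
      and far: "\<forall>a\<in>S. \<forall>b\<in>S. a \<noteq> b \<longrightarrow> graph_dist G a b \<ge> 3" by blast
    have "stable_set (graph_square G) S"
      unfolding stable_set_graph_square_iff[OF assms(1)]
      using S far by (simp add: max_stable_sets_def stable_set_def)
    then have "stability_number G \<le> stability_number (graph_square G)"
      using card_le_stability_number[OF fin, of S] S by (simp add: max_stable_sets_def)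
    then show "square_stable G"
      using stability_number_graph_square_le[OF assms(1)] by (simp add: square_stable_def)
  qed
qed

end
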